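(* There is an absolute constant $C>0$ such that the following holds. Let $d_1,\dots,d_N\in\mathbb{R}^n$ be arbitrary vectors (a dictionary, possibly linearly dependent) with $\|d_i\|_2\le 1$ for all $i$, and let $\varepsilon\ge0$. Let $x=\sum_{i=1}^N\alpha_i d_i$, where the coefficient vector $\alpha=(\alpha_1,\dots,\alpha_N)\in\mathbb{R}^N$ has at most $s$ non-zero coordinates. Let $A$ be an $m\times n$ random matrix with i.i.d. $N(0,1)$ entries and let $$y=Ax+\nu,\qquad \frac1m\|\nu\|_1=\frac1m\sum_{i=1}^m|\nu_i|\le\varepsilon,$$ where the noise vector $\nu\in\mathbb{R}^m$ is unknown and otherwise arbitrary (in particular it may depend on $A$). Choose $\widehat{x}$ to be a solution to the convex program $$\text{minimize } \|\alpha'\|_1\ \text{ such that }\ x'=\sum_{i=1}^N\alpha_i'd_i\ \text{ satisfies }\ \frac1m\|Ax'-y\|_1\le\varepsilon ,$$ that is, $\widehat{x}=\sum_{i=1}^N\widehat{\alpha}_i d_i$ where $\widehat{\alpha}\in\mathbb{R}^N$ is a minimizer. Then $$\mathbb{E}\,\|\widehat{x}-x\|_2\le C\sqrt{\frac{s\log N}{m}}\cdot\|\alpha\|_2+\sqrt{2\pi}\,\varepsilon .$$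
   Context: Here $m,n,N,s$ are positive integers. The vector $\widehat{x}$ depends on $A$ and $y$; $\|\cdot\|_1$ and $\|\cdot\|_2$ denote the $\ell_1$ and Euclidean norms.
   Formalization: N ≥ 2 is assumed: for N = 1, log N = 0 and the bound fails (m=n=s=1, d=α=1, ν=−ε·sgn(g), small ε). The probability space is carried by real sequences; the general case follows by pushing forward under the coordinates of A, ν and α̂. *)

theory Defs
  imports "HOL-Probability.Probability"
begin

text \<open>
  The constant of the theorem must not depend on the dimensions, so these are natural numbers and
  not types: a vector of \<open>\<real>\<^sup>n\<close> is a function \<open>v :: nat \<Rightarrow> real\<close> of which only the values at
  \<open>i < n\<close> are ever used, and an \<open>m \<times> n\<close> matrix is a function \<open>B :: nat \<Rightarrow> nat \<Rightarrow> real\<close> used only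
  at \<open>i < m\<close>, \<open>j < n\<close>. The Euclidean norm on \<open>\<real>\<^sup>n\<close> is the library's \<open>L2_set v {..<n}\<close>.
\<close>

definition l1_norm :: "nat \<Rightarrow> (nat \<Rightarrow> real) \<Rightarrow> real" where
  "l1_norm n v = (\<Sum>i<n. \<bar>v i\<bar>)"

abbreviation l2_norm :: "nat \<Rightarrow> (nat \<Rightarrow> real) \<Rightarrow> real" where
  "l2_norm n v \<equiv> L2_set v {..<n}"

definition mat_vec :: "nat \<Rightarrow> (nat \<Rightarrow> nat \<Rightarrow> real) \<Rightarrow> (nat \<Rightarrow> real) \<Rightarrow> nat \<Rightarrow> real" where
  "mat_vec n B x = (\<lambda>i. \<Sum>j<n. B i j * x j)"

text \<open>The element of \<open>\<real>\<^sup>n\<close> synthesised from the dictionary \<open>d 0, \<dots>, d (N - 1)\<close>; \<open>d i\<close> is the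
  \<open>i\<close>-th dictionary vector and \<open>d i j\<close> its \<open>j\<close>-th coordinate.\<close>

definition dict_comb :: "nat \<Rightarrow> (nat \<Rightarrow> nat \<Rightarrow> real) \<Rightarrow> (nat \<Rightarrow> real) \<Rightarrow> nat \<Rightarrow> real" where
  "dict_comb N d a = (\<lambda>j. \<Sum>i<N. a i * d i j)"

definition std_gaussian_matrix ::
    "'w measure \<Rightarrow> nat \<Rightarrow> nat \<Rightarrow> ('w \<Rightarrow> nat \<Rightarrow> nat \<Rightarrow> real) \<Rightarrow> bool" where
  "std_gaussian_matrix M m n A \<longleftrightarrow>
     prob_space.indep_vars M (\<lambda>_. borel) (\<lambda>(i, j) \<omega>. A \<omega> i j) ({..<m} \<times> {..<n}) \<and>
     (\<forall>i<m. \<forall>j<n. distributed M lborel (\<lambda>\<omega>. A \<omega> i j) (\<lambda>t. ennreal (std_normal_density t)))"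

definition feasible ::
    "nat \<Rightarrow> nat \<Rightarrow> nat \<Rightarrow> (nat \<Rightarrow> nat \<Rightarrow> real) \<Rightarrow> (nat \<Rightarrow> nat \<Rightarrow> real) \<Rightarrow> (nat \<Rightarrow> real) \<Rightarrow> real
      \<Rightarrow> (nat \<Rightarrow> real) \<Rightarrow> bool" where
  "feasible m n N d B y \<epsilon> a \<longleftrightarrow>
     l1_norm m (\<lambda>i. mat_vec n B (dict_comb N d a) i - y i) / real m \<le> \<epsilon>"

definition program_solution ::
    "nat \<Rightarrow> nat \<Rightarrow> nat \<Rightarrow> (nat \<Rightarrow> nat \<Rightarrow> real) \<Rightarrow> (nat \<Rightarrow> nat \<Rightarrow> real) \<Rightarrow> (nat \<Rightarrow> real) \<Rightarrow> real
      \<Rightarrow> (nat \<Rightarrow> real) \<Rightarrow> bool" where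
  "program_solution m n N d B y \<epsilon> a \<longleftrightarrow> is_arg_min (l1_norm N) (feasible m n N d B y \<epsilon>) a"

text \<open>
  The theorem is stated for probability spaces \<open>M\<close> carried by the fixed type \<open>nat \<Rightarrow> real\<close>, with
  arbitrary underlying set and sigma-algebra. With a type variable in its place the constant, which is
  quantified first, could formally depend on that type. Nothing is lost: the hypotheses and the
  conclusion involve only the finitely many real coordinates of \<open>A\<close>, \<open>\<nu>\<close> and the minimizer, so
  an arbitrary probability space can be replaced by its image under the map that lists these
  coordinates, with the largest sigma-algebra making that map measurable.

  The noise and the minimizer are arbitrary functions of the sample point, so they may depend on
  \<open>A\<close> and on further randomness. They need not be measurable; only the error whose expectation is
  taken is assumed to be. That this expectation is finite is part of the conclusion, since
  the Bochner integral of a non-integrable function is \<open>0\<close> by convention.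

  The assumption \<open>2 \<le> N\<close> cannot be relaxed to \<open>1 \<le> N\<close>: for \<open>N = 1\<close> the logarithm vanishes and the
  bound fails. With \<open>m = n = s = 1\<close>, \<open>d 0 = \<alpha> = 1\<close>, \<open>\<epsilon> > 0\<close> and \<open>\<nu> = - \<epsilon> sgn g\<close> for the single
  Gaussian entry \<open>g\<close>, the error is \<open>min 1 (2 \<epsilon> / \<bar>g\<bar>)\<close>, whose expectation is of order
  \<open>\<epsilon> ln (1 / \<epsilon>)\<close> and so exceeds \<open>sqrt (2 pi) \<epsilon>\<close> for small \<open>\<epsilon>\<close>.
\<close>

end

(* With h = alpha^ - alpha and R = 2 ||alpha||_1 <= 2 sqrt s ||alpha||_2, minimality of alpha^ gives
   ||h||_1 <= R, and feasibility of both vectors gives ||A u||_1 / m <= 2 eps for u = sum h_k d_k = x^ - x.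
   Since E |<a,u>| = sqrt (2 / pi) ||u||_2 for a Gaussian row a, it remains to bound the expected supremum
   over ||h||_1 <= R of sum_i (E |<a_i,u>| - |<a_i,u>|). Replacing the rows one at a time, each
   centred term can be exchanged for 2 <a_i,u> (symmetrization and contraction in one step, with the
   symmetry of a_i playing the part of the random signs and no independent copy needed). The
   resulting linear functional of h is at most 2 R max_k |<sum_i a_i, d_k>|, a maximum of N Gaussians of
   variance at most m. *)
theory Submission
  imports Defs
begin

section \<open>Symmetrization and contraction for one row\<close>

lemma (in prob_space) expectation_MAX_centred_abs_le:
  fixes c :: "'u \<Rightarrow> real" and L :: "'u \<Rightarrow> 'a \<Rightarrow> real"
  assumes F: "finite F" "F \<noteq> {}"
    and L: "\<And>u. u \<in> F \<Longrightarrow> integrable M (L u)"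
    and sym: "expectation (\<lambda>\<omega>. MAX u\<in>F. c u - 2 * L u \<omega>) = expectation (\<lambda>\<omega>. MAX u\<in>F. c u + 2 * L u \<omega>)"
  shows "expectation (\<lambda>\<omega>. MAX u\<in>F. c u + (expectation (\<lambda>\<omega>. \<bar>L u \<omega>\<bar>) - \<bar>L u \<omega>\<bar>))
           \<le> expectation (\<lambda>\<omega>. MAX u\<in>F. c u + 2 * L u \<omega>)"
proof -
  txt \<open>With \<open>\<Phi> t = (MAX u\<in>F. c u + t u)\<close>, convexity gives
    \<open>2 \<Phi> (\<mu> - \<bar>L\<bar>) \<le> \<Phi> (2 \<mu>) + \<Phi> (- 2 \<bar>L\<bar>)\<close>, Jensen gives \<open>\<Phi> (2 \<mu>) \<le> E \<Phi> (2 \<bar>L\<bar>)\<close>, and pointwise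
    \<open>\<Phi> (2 \<bar>L\<bar>) + \<Phi> (- 2 \<bar>L\<bar>) \<le> \<Phi> (2 L) + \<Phi> (- 2 L)\<close>.\<close>
  define \<mu> where "\<mu> u = expectation (\<lambda>\<omega>. \<bar>L u \<omega>\<bar>)" for u
  define P where "P \<omega> = (MAX u\<in>F. c u + 2 * L u \<omega>)" for \<omega>
  define P' where "P' \<omega> = (MAX u\<in>F. c u - 2 * L u \<omega>)" for \<omega>
  define Q where "Q \<omega> = (MAX u\<in>F. c u + 2 * \<bar>L u \<omega>\<bar>)" for \<omega>
  define Q' where "Q' \<omega> = (MAX u\<in>F. c u - 2 * \<bar>L u \<omega>\<bar>)" for \<omega>
  define R where "R \<omega> = (MAX u\<in>F. c u + (\<mu> u - \<bar>L u \<omega>\<bar>))" for \<omega>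
  define q where "q = (MAX u\<in>F. c u + 2 * \<mu> u)"
  have int: "integrable M P" "integrable M P'" "integrable M Q" "integrable M Q'" "integrable M R"
    unfolding P_def P'_def Q_def Q'_def R_def using L by (auto intro!: integrable_MAX F)
  have le_MAX: "f u \<le> (MAX u\<in>F. f u)" if "u \<in> F" for u and f :: "'u \<Rightarrow> real"
    using F that by simp
  have q: "q \<le> expectation Q"
    unfolding q_def
  proof (intro Max.boundedI)
    fix a assume "a \<in> (\<lambda>u. c u + 2 * \<mu> u) ` F"
    then obtain u where u: "u \<in> F" "a = c u + 2 * \<mu> u" by blast
    have "a = expectation (\<lambda>\<omega>. c u + 2 * \<bar>L u \<omega>\<bar>)"
      using L[OF u(1)] by (simp add: u(2) \<mu>_def prob_space)
    also have "\<dots> \<le> expectation Q"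
      using L[OF u(1)] int le_MAX[OF u(1)] by (intro integral_mono) (auto simp: Q_def)
    finally show "a \<le> expectation Q" .
  qed (use F in auto)
  have convex: "2 * R \<omega> \<le> q + Q' \<omega>" for \<omega>
  proof -
    have "R \<omega> \<le> (q + Q' \<omega>) / 2"
      unfolding R_def
    proof (intro Max.boundedI)
      fix a assume "a \<in> (\<lambda>u. c u + (\<mu> u - \<bar>L u \<omega>\<bar>)) ` F"
      then obtain u where u: "u \<in> F" "a = c u + (\<mu> u - \<bar>L u \<omega>\<bar>)" by blast
      show "a \<le> (q + Q' \<omega>) / 2"
        using le_MAX[OF u(1), of "\<lambda>u. c u + 2 * \<mu> u"] le_MAX[OF u(1), of "\<lambda>u. c u - 2 * \<bar>L u \<omega>\<bar>"]
        by (simp add: u(2) q_def Q'_def field_simps)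
    qed (use F in auto)
    then show ?thesis by simp
  qed
  have contraction: "Q \<omega> + Q' \<omega> \<le> P \<omega> + P' \<omega>" for \<omega>
  proof -
    have "Q \<omega> \<in> (\<lambda>u. c u + 2 * \<bar>L u \<omega>\<bar>) ` F" "Q' \<omega> \<in> (\<lambda>u. c u - 2 * \<bar>L u \<omega>\<bar>) ` F"
      unfolding Q_def Q'_def using F by (intro Max_in; simp)+
    then obtain u v where uv: "u \<in> F" "v \<in> F" and eq: "Q \<omega> = c u + 2 * \<bar>L u \<omega>\<bar>" "Q' \<omega> = c v - 2 * \<bar>L v \<omega>\<bar>"
      by blast
    \<comment> \<open>If \<open>L u \<omega>\<close> is nonnegative, pair \<open>u\<close> with
      \<open>P\<close> and \<open>v\<close> with \<open>P'\<close>; otherwise swap the two. Either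
      pairing is admissible for \<open>v\<close>, since -2 |L v| lies below both 2 L v and -2 L
      v.\<close>
    have "c u + 2 * L u \<omega> \<le> P \<omega>" "c u - 2 * L u \<omega> \<le> P' \<omega>" "c v + 2 * L v \<omega> \<le> P \<omega>" "c v - 2 * L v \<omega> \<le> P' \<omega>"
      unfolding P_def P'_def using uv by (auto intro: le_MAX)
    then show ?thesis unfolding eq by linarith
  qed
  have "2 * expectation R \<le> expectation (\<lambda>\<omega>. q + Q' \<omega>)"
    unfolding integral_mult_right_zero[symmetric] using int convex by (intro integral_mono) auto
  also have "\<dots> \<le> expectation Q + expectation Q'"
    using q int by (simp add: prob_space)
  also have "\<dots> \<le> expectation (\<lambda>\<omega>. P \<omega> + P' \<omega>)"
    using int contraction
    by (subst Bochner_Integration.integral_add[symmetric]) (auto intro!: integral_mono simp del: Bochner_Integration.integral_add)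
  also have "\<dots> = 2 * expectation P"
    using int sym[folded P_def P'_def] by simp
  finally show ?thesis
    unfolding R_def P_def \<mu>_def by simp
qed

section \<open>Standard Gaussian vectors\<close>

definition std_gauss :: "real measure" where
  "std_gauss = density lborel std_normal_density"

abbreviation std_gauss_vec :: "'k set \<Rightarrow> ('k \<Rightarrow> real) measure" where
  "std_gauss_vec K \<equiv> PiM K (\<lambda>_. std_gauss)"

lemma sets_std_gauss [measurable_cong, simp]: "sets std_gauss = sets borel"
  and space_std_gauss [simp]: "space std_gauss = UNIV"
  by (simp_all add: std_gauss_def)

lemma prob_space_std_gauss: "prob_space std_gauss"
  unfolding std_gauss_def by (rule prob_space_normal_density) simp

lemma prob_space_std_gauss_vec: "prob_space (std_gauss_vec K)"
  by (intro prob_space_PiM prob_space_std_gauss)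

lemma product_sigma_finite_std_gauss: "product_sigma_finite (\<lambda>_. std_gauss)"
  by (simp add: product_sigma_finite_def prob_space_imp_sigma_finite prob_space_std_gauss)

lemma distr_std_gauss_uminus: "distr std_gauss std_gauss uminus = std_gauss"
proof -
  interpret g: prob_space std_gauss by (rule prob_space_std_gauss)
  have "distributed std_gauss lborel (\<lambda>x. x) std_normal_density"
    by (simp add: distributed_def std_gauss_def distr_id2 cong: distr_cong)
  from g.normal_density_affine[OF this, of "-1" 0]
  have "distr std_gauss lborel uminus = std_gauss"
    by (simp add: distributed_def std_gauss_def)
  then show ?thesis
    by (simp cong: distr_cong)
qed

lemma distributed_std_gauss_vec_component:
  assumes "k \<in> K"
  shows "distributed (std_gauss_vec K) lborel (\<lambda>g. g k) std_normal_density"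
proof -
  have "distr (std_gauss_vec K) std_gauss (\<lambda>g. g k) = std_gauss"
    using assms by (intro distr_PiM_component prob_space_std_gauss)
  then have "distr (std_gauss_vec K) lborel (\<lambda>g. g k) = std_gauss"
    by (simp cong: distr_cong)
  then show ?thesis
    using assms by (simp add: distributed_def std_gauss_def)
qed

text \<open>Independence is read off from the joint law, which is the product of the laws of the
  coordinates. That characterization is for nonempty index sets, hence the separate case.\<close>

lemma indep_vars_std_gauss_vec:
  assumes "finite K"
  shows "prob_space.indep_vars (std_gauss_vec K) (\<lambda>_. borel) (\<lambda>k g. g k) K"
proof (cases "K = {}")
  case False
  interpret prob_space "std_gauss_vec K" by (rule prob_space_std_gauss_vec)
  have "distr (std_gauss_vec K) (PiM K (\<lambda>_. borel)) (\<lambda>g. \<lambda>k\<in>K. g k)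
      = distr (std_gauss_vec K) (std_gauss_vec K) (\<lambda>g. g)"
    by (intro distr_cong) (auto simp: space_PiM restrict_PiE_iff extensional_restrict PiE_iff intro!: sets_PiM_cong)
  also have "\<dots> = std_gauss_vec K" by (rule distr_id2) simp
  also have "\<dots> = PiM K (\<lambda>k. distr (std_gauss_vec K) borel (\<lambda>g. g k))"
  proof (intro PiM_cong refl)
    fix k assume "k \<in> K"
    then have "std_gauss = distr (std_gauss_vec K) std_gauss (\<lambda>g. g k)"
      by (subst distr_PiM_component) (auto intro: prob_space_std_gauss)
    then show "std_gauss = distr (std_gauss_vec K) borel (\<lambda>g. g k)"
      by (simp cong: distr_cong)
  qed
  finally show ?thesis
    using False by (subst indep_vars_iff_distr_eq_PiM') auto
qed (simp add: prob_space.indep_vars_def2[OF prob_space_std_gauss_vec] prob_space.indep_sets_def[OF prob_space_std_gauss_vec])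

section \<open>Moments and linear images of Gaussian vectors\<close>

lemma integral_std_gauss_abs: "(\<integral>t. \<bar>t\<bar> \<partial>std_gauss) = sqrt (2 / pi)"
  using integral_std_normal_moment_abs_odd[of 0]
  by (simp add: std_gauss_def integral_real_density)

text \<open>Completing the square turns the tilted density into exp (l^2 / 2) times the normal
  density with mean \<open>l\<close> and variance 1, whose total mass is 1.\<close>

lemma integrable_std_gauss_exp: "integrable std_gauss (\<lambda>t. exp (l * t))" (is ?int)
  and integral_std_gauss_exp: "(\<integral>t. exp (l * t) \<partial>std_gauss) = exp (l\<^sup>2 / 2)" (is ?eq)
proof -
  have eq: "std_normal_density t * exp (l * t) = exp (l\<^sup>2 / 2) * normal_density l 1 t" for t
  proof -
    have "- t\<^sup>2 / 2 + l * t = l\<^sup>2 / 2 - (t - l)\<^sup>2 / 2"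
      by (simp add: power2_eq_square field_simps)
    then have "exp (- t\<^sup>2 / 2) * exp (l * t) = exp (l\<^sup>2 / 2) * exp (- (t - l)\<^sup>2 / 2)"
      unfolding exp_add[symmetric] by (simp add: algebra_simps)
    then show ?thesis
      by (simp add: normal_density_def field_simps)
  qed
  show ?int by (simp add: std_gauss_def integrable_real_density eq)
  show ?eq by (simp add: std_gauss_def integral_real_density eq)
qed

text \<open>The law is expressed as the image of a single standard Gaussian under scaling, not by a
  normal density, so that vanishing \<open>w\<close> (a point mass at 0) is covered by the same
  formula.\<close>

lemma distr_std_gauss_vec_sum:
  assumes K: "finite K"
  shows "distr (std_gauss_vec K) borel (\<lambda>g. \<Sum>k\<in>K. g k * w k) = distr std_gauss borel (\<lambda>t. L2_set w K * t)"
proof -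
  interpret prob_space "std_gauss_vec K" by (rule prob_space_std_gauss_vec)
  interpret g: prob_space std_gauss by (rule prob_space_std_gauss)
  \<comment> \<open>Zero weights are discarded because the addition theorem for independent normal
    variables requires positive standard deviations and a nonempty index set.\<close>
  define K' where "K' = {k\<in>K. w k \<noteq> 0}"
  define \<sigma> where "\<sigma> = L2_set w K"
  have K': "finite K'" "K' \<subseteq> K" using K by (auto simp: K'_def)
  have sum: "(\<lambda>g. \<Sum>k\<in>K. g k * w k) = (\<lambda>g. \<Sum>k\<in>K'. g k * w k)"
    by (intro ext sum.mono_neutral_right) (use K in \<open>auto simp: K'_def\<close>)
  have \<sigma>: "\<sigma> = sqrt (\<Sum>k\<in>K'. \<bar>w k\<bar>\<^sup>2)"
    unfolding \<sigma>_def L2_set_def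
    by (intro arg_cong[where f=sqrt] sum.mono_neutral_cong_right) (use K in \<open>auto simp: K'_def\<close>)
  show ?thesis
  proof (cases "K' = {}")
    case True
    then show ?thesis unfolding \<sigma>_def[symmetric] by (simp add: sum \<sigma>)
  next
    case False
    have "distributed (std_gauss_vec K) lborel (\<lambda>g. g k * w k) (normal_density 0 \<bar>w k\<bar>)" if "k \<in> K'" for k
      using normal_density_affine[OF distributed_std_gauss_vec_component[of k K], where \<alpha>="w k" and \<beta>=0] that
      by (simp add: K'_def mult.commute)
    moreover have "indep_vars (\<lambda>_. borel) (\<lambda>k g. g k * w k) K'"
      using indep_vars_compose2[OF indep_vars_subset[OF indep_vars_std_gauss_vec[OF K] K'(2)],
            where Y="\<lambda>k t. t * w k" and N="\<lambda>_. borel"]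
      by simp
    ultimately have D: "distributed (std_gauss_vec K) lborel (\<lambda>g. \<Sum>k\<in>K'. g k * w k) (normal_density 0 \<sigma>)"
      using sum_indep_normal[of K' "\<lambda>k g. g k * w k" "\<lambda>k. \<bar>w k\<bar>" "\<lambda>_. 0"] K'(1) False
      by (auto simp: \<sigma> K'_def)
    have "(\<Sum>k\<in>K'. \<bar>w k\<bar>\<^sup>2) > 0"
      using False K' by (intro sum_pos) (auto simp: K'_def)
    then have pos: "\<sigma> > 0" by (simp add: \<sigma>)
    have "distributed std_gauss lborel (\<lambda>x. x) std_normal_density"
      by (simp add: distributed_def std_gauss_def distr_id2 cong: distr_cong)
    from g.normal_density_affine[OF this _ less_imp_neq[OF pos, symmetric], of 0] pos
    have D': "distributed std_gauss lborel (\<lambda>t. \<sigma> * t) (normal_density 0 \<sigma>)" by simp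
    have "distr (std_gauss_vec K) lborel (\<lambda>g. \<Sum>k\<in>K'. g k * w k) = distr std_gauss lborel (\<lambda>t. \<sigma> * t)"
      using D D' by (simp add: distributed_def)
    then show ?thesis
      unfolding sum \<sigma>_def[symmetric] by (simp cong: distr_cong)
  qed
qed

lemma
  fixes f :: "real \<Rightarrow> real"
  assumes "finite K" and [measurable]: "f \<in> borel_measurable borel"
  shows integral_std_gauss_vec_sum:
    "(\<integral>g. f (\<Sum>k\<in>K. g k * w k) \<partial>std_gauss_vec K) = (\<integral>t. f (L2_set w K * t) \<partial>std_gauss)"
    and integrable_std_gauss_vec_sum_iff:
    "integrable (std_gauss_vec K) (\<lambda>g. f (\<Sum>k\<in>K. g k * w k)) \<longleftrightarrow> integrable std_gauss (\<lambda>t. f (L2_set w K * t))"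
proof -
  note distr = distr_std_gauss_vec_sum[OF assms(1), of w]
  show "(\<integral>g. f (\<Sum>k\<in>K. g k * w k) \<partial>std_gauss_vec K) = (\<integral>t. f (L2_set w K * t) \<partial>std_gauss)"
    using arg_cong[OF distr, of "\<lambda>N. integral\<^sup>L N f"] by (simp add: integral_distr)
  show "integrable (std_gauss_vec K) (\<lambda>g. f (\<Sum>k\<in>K. g k * w k)) \<longleftrightarrow> integrable std_gauss (\<lambda>t. f (L2_set w K * t))"
    using arg_cong[OF distr, of "\<lambda>N. integrable N f"] by (simp add: integrable_distr_eq)
qed

lemma (in product_sigma_finite) product_integral_fold_mono:
  fixes f h :: "_ \<Rightarrow> real"
  assumes IJ: "I \<inter> J = {}" and fin: "finite I" "finite J"
    and f: "integrable (Pi\<^sub>M (I \<union> J) M) f" and h: "integrable (Pi\<^sub>M (I \<union> J) M) h"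
    and le: "\<And>x. (\<integral>y. f (merge I J (x, y)) \<partial>Pi\<^sub>M J M) \<le> (\<integral>y. h (merge I J (x, y)) \<partial>Pi\<^sub>M J M)"
  shows "integral\<^sup>L (Pi\<^sub>M (I \<union> J) M) f \<le> integral\<^sup>L (Pi\<^sub>M (I \<union> J) M) h"
proof -
  interpret I: finite_product_sigma_finite M I by standard fact
  interpret J: finite_product_sigma_finite M J by standard fact
  interpret P: pair_sigma_finite "Pi\<^sub>M I M" "Pi\<^sub>M J M" ..
  have *: "integrable (Pi\<^sub>M I M) (\<lambda>x. \<integral>y. k (merge I J (x, y)) \<partial>Pi\<^sub>M J M)"
    if "integrable (Pi\<^sub>M (I \<union> J) M) k" for k :: "_ \<Rightarrow> real"
  proof (rule P.integrable_fst')
    show "integrable (Pi\<^sub>M I M \<Otimes>\<^sub>M Pi\<^sub>M J M) (\<lambda>x. k (merge I J x))"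
      by (rule integrable_distr[OF measurable_merge]) (simp add: distr_merge[OF IJ fin] that)
  qed
  show ?thesis
    unfolding product_integral_fold[OF IJ fin f] product_integral_fold[OF IJ fin h]
    by (intro integral_mono * f h le)
qed

text \<open>Each coordinate has a symmetric law, and the coordinates are reflected simultaneously.
  The restriction to \<open>K\<close> keeps the reflected point extensional, as points of a product
  space have to be.\<close>

lemma integral_std_gauss_vec_uminus:
  fixes f :: "_ \<Rightarrow> real"
  assumes K: "finite K" and f: "f \<in> borel_measurable (std_gauss_vec K)"
  shows "(\<integral>g. f (\<lambda>k\<in>K. - g k) \<partial>std_gauss_vec K) = integral\<^sup>L (std_gauss_vec K) f"
proof -
  have "compose K uminus \<in> std_gauss_vec K \<rightarrow>\<^sub>M std_gauss_vec K"
    unfolding compose_def by measurable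
  then have "(\<integral>g. f (\<lambda>k\<in>K. - g k) \<partial>std_gauss_vec K)
      = integral\<^sup>L (distr (std_gauss_vec K) (std_gauss_vec K) (compose K uminus)) f"
    by (subst integral_distr) (auto simp: compose_def intro!: f)
  also have "distr (std_gauss_vec K) (std_gauss_vec K) (compose K uminus) = std_gauss_vec K"
    using K by (subst distr_PiM_finite_prob_space') (auto simp: prob_space_std_gauss distr_std_gauss_uminus)
  finally show ?thesis .
qed

lemma integrable_std_gauss_vec_component:
  assumes "k \<in> K"
  shows "integrable (std_gauss_vec K) (\<lambda>g. g k)"
  using distributed_integrable_var[OF distributed_std_gauss_vec_component[OF assms]] integrable_std_normal_moment[of 1]
  by (simp add: normal_density_nonneg)

lemma integrable_std_gauss_vec_row:
  assumes "{i} \<times> J \<subseteq> K"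
  shows "integrable (std_gauss_vec K) (\<lambda>g. \<Sum>j\<in>J. g (i, j) * w j)"
  using assms by (intro Bochner_Integration.integrable_sum integrable_mult_left integrable_std_gauss_vec_component) auto

lemma integral_abs_std_gauss_vec_sum:
  assumes K: "finite K"
  shows "(\<integral>g. \<bar>\<Sum>k\<in>K. g k * w k\<bar> \<partial>std_gauss_vec K) = sqrt (2 / pi) * L2_set w K"
  by (subst integral_std_gauss_vec_sum[OF K]) (auto simp: abs_mult integral_std_gauss_abs)

lemma sum_singleton_Times: "(\<Sum>k\<in>{i} \<times> J. f k) = (\<Sum>j\<in>J. f (i, j))"
  by (rule sum.reindex_cong[of "Pair i"]) (auto simp: inj_on_def)

lemma integral_abs_std_gauss_vec_row:
  assumes J: "finite J"
  shows "(\<integral>g. \<bar>\<Sum>j\<in>J. g (i, j) * w j\<bar> \<partial>std_gauss_vec ({i} \<times> J)) = sqrt (2 / pi) * L2_set w J"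
proof -
  have "L2_set (\<lambda>k. w (snd k)) ({i} \<times> J) = L2_set w J"
    unfolding L2_set_def sum_singleton_Times by simp
  then show ?thesis
    using integral_abs_std_gauss_vec_sum[of "{i} \<times> J" "\<lambda>k. w (snd k)"] J
    by (simp add: sum_singleton_Times)
qed

section \<open>Expected maxima\<close>

lemma integral_MAX_centred_row_le:
  fixes w :: "'u \<Rightarrow> 'j \<Rightarrow> real" and i :: 'i
  assumes J: "finite J" and F: "finite F" "F \<noteq> {}"
  shows "(\<integral>g. (MAX u\<in>F. c u + (sqrt (2 / pi) * L2_set (w u) J - \<bar>\<Sum>j\<in>J. g (i, j) * w u j\<bar>)) \<partial>std_gauss_vec ({i} \<times> J))
      \<le> (\<integral>g. (MAX u\<in>F. c u + 2 * (\<Sum>j\<in>J. g (i, j) * w u j)) \<partial>std_gauss_vec ({i} \<times> J))"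
proof -
  interpret prob_space "std_gauss_vec ({i} \<times> J)" by (rule prob_space_std_gauss_vec)
  let ?L = "\<lambda>u g. \<Sum>j\<in>J. g (i, j) * w u j"
  have int: "integrable (std_gauss_vec ({i} \<times> J)) (?L u)" for u
    by (rule integrable_std_gauss_vec_row) simp
  \<comment> \<open>Reflecting the row flips the sign of all the linear forms \<open>?L u\<close> at
    once, which gives the hypothesis \<open>sym\<close> of the one-row inequality.\<close>
  have "expectation (\<lambda>g. MAX u\<in>F. c u - 2 * ?L u g) = expectation (\<lambda>g. MAX u\<in>F. c u + 2 * ?L u (\<lambda>k\<in>{i} \<times> J. - g k))"
    by (simp add: sum_negf)
  also have "\<dots> = expectation (\<lambda>g. MAX u\<in>F. c u + 2 * ?L u g)"
    using int J F
    by (intro integral_std_gauss_vec_uminus borel_measurable_integrable integrable_MAX Bochner_Integration.integrable_add) auto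
  finally show ?thesis
    using expectation_MAX_centred_abs_le[of F ?L c, OF F int] J
    by (simp add: integral_abs_std_gauss_vec_row)
qed

text \<open>Induction over the rows. The offset \<open>c\<close> is kept arbitrary because the
  contribution of the rows that are frozen at each stage, which depends on \<open>u\<close>, is
  absorbed into it.\<close>

lemma integral_MAX_centred_rows_le:
  fixes w :: "'u \<Rightarrow> 'j \<Rightarrow> real" and I :: "'i set"
  assumes I: "finite I" and J: "finite J" and F: "finite F" "F \<noteq> {}"
  shows "(\<integral>g. (MAX u\<in>F. c u + (\<Sum>i\<in>I. sqrt (2 / pi) * L2_set (w u) J - \<bar>\<Sum>j\<in>J. g (i, j) * w u j\<bar>)) \<partial>std_gauss_vec (I \<times> J))
      \<le> (\<integral>g. (MAX u\<in>F. c u + 2 * (\<Sum>i\<in>I. \<Sum>j\<in>J. g (i, j) * w u j)) \<partial>std_gauss_vec (I \<times> J))"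
  using I
proof (induction I arbitrary: c rule: finite_induct)
  case empty
  show ?case by simp
next
  case (insert i I)
  interpret product_sigma_finite "\<lambda>_. std_gauss" by (rule product_sigma_finite_std_gauss)
  define S where "S i' u g = (\<Sum>j\<in>J. g (i', j) * w u j)" for i' :: 'i and u and g :: "'i \<times> 'j \<Rightarrow> real"
  define T where "T i' u g = sqrt (2 / pi) * L2_set (w u) J - \<bar>S i' u g\<bar>" for i' u g
  let ?A = "I \<times> J" and ?B = "{i} \<times> J"
  have K: "insert i I \<times> J = ?A \<union> ?B" "insert i I \<times> J = ?B \<union> ?A" by auto
  have disj: "?A \<inter> ?B = {}" "?B \<inter> ?A = {}" and fin: "finite ?A" "finite ?B"
    using insert.hyps J by auto
  interpret P: prob_space "std_gauss_vec (insert i I \<times> J)" by (rule prob_space_std_gauss_vec)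
  have int_S: "integrable (std_gauss_vec (insert i I \<times> J)) (S i' u)" if "i' \<in> insert i I" for i' u
    unfolding S_def using that by (intro integrable_std_gauss_vec_row) auto
  then have int_T: "integrable (std_gauss_vec (insert i I \<times> J)) (T i' u)" if "i' \<in> insert i I" for i' u
    unfolding T_def using that by auto
  define f0 where "f0 g = (MAX u\<in>F. c u + (\<Sum>i\<in>insert i I. T i u g))" for g
  \<comment> \<open>The hybrid between \<open>f0\<close> and \<open>f2\<close>: row \<open>i\<close>
    is already replaced by its linear form, the rows in \<open>I\<close> still carry the centred
    absolute values.\<close>
  define f1 where "f1 g = (MAX u\<in>F. c u + 2 * S i u g + (\<Sum>i\<in>I. T i u g))" for g
  define f2 where "f2 g = (MAX u\<in>F. c u + 2 * (\<Sum>i\<in>insert i I. S i u g))" for g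
  have int: "integrable (std_gauss_vec (insert i I \<times> J)) f0" "integrable (std_gauss_vec (insert i I \<times> J)) f1"
    "integrable (std_gauss_vec (insert i I \<times> J)) f2"
    unfolding f0_def f1_def f2_def using int_S int_T
    by (intro integrable_MAX F Bochner_Integration.integrable_add Bochner_Integration.integrable_sum integrable_mult_right; simp)+
  have S_merge: "S i' u (merge ?A ?B (x, y)) = S i' u x" "S i' u (merge ?B ?A (y, x)) = S i' u x"
      "T i' u (merge ?A ?B (x, y)) = T i' u x" "T i' u (merge ?B ?A (y, x)) = T i' u x"
    if "i' \<in> I" for i' u x y
    using that insert.hyps by (auto simp: S_def T_def merge_def intro!: sum.cong arg_cong[where f=abs])
  have S_merge_i: "S i u (merge ?A ?B (x, y)) = S i u y" "S i u (merge ?B ?A (y, x)) = S i u y"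
      "T i u (merge ?A ?B (x, y)) = T i u y"
    for u x y
    using insert.hyps by (auto simp: S_def T_def merge_def intro!: sum.cong arg_cong[where f=abs])
  \<comment> \<open>First exchange: the rows in \<open>I\<close> are frozen and the one-row
    inequality is applied to row \<open>i\<close>.\<close>
  have "integral\<^sup>L (std_gauss_vec (insert i I \<times> J)) f0 \<le> integral\<^sup>L (std_gauss_vec (insert i I \<times> J)) f1"
    unfolding K(1)
  proof (rule product_integral_fold_mono[OF disj(1) fin])
    fix x
    have "f0 (merge ?A ?B (x, y)) = (MAX u\<in>F. (c u + (\<Sum>i\<in>I. T i u x)) + T i u y)"
      "f1 (merge ?A ?B (x, y)) = (MAX u\<in>F. (c u + (\<Sum>i\<in>I. T i u x)) + 2 * S i u y)" for y
      using insert.hyps by (simp_all add: f0_def f1_def S_merge S_merge_i add_ac cong: sum.cong)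
    then show "(\<integral>y. f0 (merge ?A ?B (x, y)) \<partial>std_gauss_vec ?B) \<le> (\<integral>y. f1 (merge ?A ?B (x, y)) \<partial>std_gauss_vec ?B)"
      using integral_MAX_centred_row_le[OF J F, where c="\<lambda>u. c u + (\<Sum>i\<in>I. T i u x)" and w=w and i=i]
      by (simp add: T_def S_def)
  qed (use int K(1) in simp_all)
  \<comment> \<open>Second exchange: row \<open>i\<close> is frozen, and the induction hypothesis is
    used with its linear form added to the offset.\<close>
  also have "integral\<^sup>L (std_gauss_vec (insert i I \<times> J)) f1 \<le> integral\<^sup>L (std_gauss_vec (insert i I \<times> J)) f2"
    unfolding K(2)
  proof (rule product_integral_fold_mono[OF disj(2) fin(2,1)])
    fix y
    have "f1 (merge ?B ?A (y, x)) = (MAX u\<in>F. (c u + 2 * S i u y) + (\<Sum>i\<in>I. T i u x))"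
      "f2 (merge ?B ?A (y, x)) = (MAX u\<in>F. (c u + 2 * S i u y) + 2 * (\<Sum>i\<in>I. S i u x))" for x
      using insert.hyps by (simp_all add: f1_def f2_def S_merge S_merge_i add_ac distrib_left cong: sum.cong)
    then show "(\<integral>x. f1 (merge ?B ?A (y, x)) \<partial>std_gauss_vec ?A) \<le> (\<integral>x. f2 (merge ?B ?A (y, x)) \<partial>std_gauss_vec ?A)"
      using insert.IH[of "\<lambda>u. c u + 2 * S i u y"] by (simp add: T_def S_def)
  qed (use int K(2) in simp_all)
  finally show ?case
    unfolding f0_def f2_def T_def S_def .
qed

text \<open>Exponential moments: the exponential of the largest |X d| is dominated by the sum of exp
  (l X d) + exp (- l X d) over \<open>D\<close>. The two signs account for the factor 2 inside the
  logarithm.\<close>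

lemma integral_MAX_abs_std_gauss_vec_sum_le:
  fixes w :: "'d \<Rightarrow> 'k \<Rightarrow> real"
  assumes K: "finite K" and D: "finite D" "D \<noteq> {}" and \<sigma>: "0 < \<sigma>"
    and w: "\<And>d. d \<in> D \<Longrightarrow> L2_set (w d) K \<le> \<sigma>"
  shows "(\<integral>g. (MAX d\<in>D. \<bar>\<Sum>k\<in>K. g k * w d k\<bar>) \<partial>std_gauss_vec K) \<le> \<sigma> * sqrt (2 * ln (2 * real (card D)))"
proof -
  interpret prob_space "std_gauss_vec K" by (rule prob_space_std_gauss_vec)
  define X where "X d g = (\<Sum>k\<in>K. g k * w d k)" for d and g :: "'k \<Rightarrow> real"
  define \<Lambda> where "\<Lambda> = ln (2 * real (card D))"
  have card: "1 \<le> real (card D)" using D by (simp add: Suc_leI card_gt_0_iff)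
  then have \<Lambda>: "\<Lambda> > 0" unfolding \<Lambda>_def by (intro ln_gt_zero) auto
  define l where "l = sqrt (2 * \<Lambda>) / \<sigma>"
  have l: "l > 0" "(l * \<sigma>)\<^sup>2 = 2 * \<Lambda>" using \<Lambda> \<sigma> by (auto simp: l_def)
  txt \<open>\<open>l\<close> minimizes the bound \<open>(\<Lambda> + l\<^sup>2 \<sigma>\<^sup>2 / 2) / l\<close> on the expected maximum.\<close>
  define B where "B = exp (2 * \<Lambda>)"
  have B: "B = 2 * real (card D) * exp ((l * \<sigma>)\<^sup>2 / 2)"
  proof -
    have "exp \<Lambda> = 2 * real (card D)" using card by (simp add: \<Lambda>_def)
    then show ?thesis unfolding l(2) by (simp add: B_def exp_double power2_eq_square)
  qed
  have int_exp: "integrable (std_gauss_vec K) (\<lambda>g. exp (a * X d g))" for a d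
    unfolding X_def using integrable_std_gauss_exp[of "a * L2_set (w d) K"]
    by (subst integrable_std_gauss_vec_sum_iff[OF K, of "\<lambda>t. exp (a * t)"]) (auto simp: mult.assoc)
  have exp_le: "expectation (\<lambda>g. exp (a * X d g)) \<le> exp ((l * \<sigma>)\<^sup>2 / 2)" if "d \<in> D" "\<bar>a\<bar> = l" for a d
  proof -
    have "expectation (\<lambda>g. exp (a * X d g)) = exp ((a * L2_set (w d) K)\<^sup>2 / 2)"
      unfolding X_def using integral_std_gauss_exp[of "a * L2_set (w d) K"]
      by (subst integral_std_gauss_vec_sum[OF K, of "\<lambda>t. exp (a * t)"]) (auto simp: mult.assoc)
    also have "(a * L2_set (w d) K)\<^sup>2 \<le> (l * \<sigma>)\<^sup>2"
      using that w[of d] l(1) \<sigma> by (intro power2_le_iff_abs_le[THEN iffD2]) (auto simp: abs_mult intro!: mult_mono)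
    finally show ?thesis by simp
  qed
  define E where "E g = (\<Sum>d\<in>D. exp (l * X d g) + exp (- l * X d g))" for g
  have int_E: "integrable (std_gauss_vec K) E" unfolding E_def
    by (intro Bochner_Integration.integrable_sum Bochner_Integration.integrable_add int_exp)
  have "expectation E = (\<Sum>d\<in>D. expectation (\<lambda>g. exp (l * X d g)) + expectation (\<lambda>g. exp (- l * X d g)))"
    unfolding E_def using int_exp[of l] int_exp[of "- l"] by simp
  also have "\<dots> \<le> (\<Sum>d\<in>D. exp ((l * \<sigma>)\<^sup>2 / 2) + exp ((l * \<sigma>)\<^sup>2 / 2))"
    using l by (intro sum_mono add_mono exp_le) auto
  also have "\<dots> = B" by (simp add: B)
  finally have E_le: "expectation E \<le> B" .
  \<comment> \<open>This is ln E <= ln B + E / B - 1, the tangent to the logarithm at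
    \<open>B\<close>, with ln B = 2 \<Lambda>. Since the mean of \<open>E\<close> is at most
    \<open>B\<close>, integrating it does the work of Jensen's inequality.\<close>
  have ptw: "l * (MAX d\<in>D. \<bar>X d g\<bar>) \<le> 2 * \<Lambda> - 1 + E g / B" for g
  proof -
    have "(MAX d\<in>D. \<bar>X d g\<bar>) \<in> (\<lambda>d. \<bar>X d g\<bar>) ` D" using D by (intro Max_in) auto
    then obtain d where d: "d \<in> D" "(MAX d\<in>D. \<bar>X d g\<bar>) = \<bar>X d g\<bar>" by blast
    have "exp (l * \<bar>X d g\<bar>) \<le> exp (l * X d g) + exp (- l * X d g)"
      by (cases "X d g \<ge> 0") auto
    also have "\<dots> \<le> E g"
      unfolding E_def using D d(1) by (intro member_le_sum[of d D "\<lambda>d. exp (l * X d g) + exp (- l * X d g)"]) (auto intro: add_nonneg_nonneg)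
    finally have "exp (l * \<bar>X d g\<bar>) / B \<le> E g / B" by (intro divide_right_mono) (auto simp: B_def)
    moreover have "1 + (l * \<bar>X d g\<bar> - 2 * \<Lambda>) \<le> exp (l * \<bar>X d g\<bar> - 2 * \<Lambda>)"
      by (rule exp_ge_add_one_self)
    ultimately show ?thesis
      unfolding d(2) by (simp add: B_def exp_diff)
  qed
  have int_X: "integrable (std_gauss_vec K) (X d)" for d
    unfolding X_def by (intro Bochner_Integration.integrable_sum integrable_mult_left integrable_std_gauss_vec_component)
  have "l * expectation (\<lambda>g. MAX d\<in>D. \<bar>X d g\<bar>) = expectation (\<lambda>g. l * (MAX d\<in>D. \<bar>X d g\<bar>))" by simp
  also have "\<dots> \<le> expectation (\<lambda>g. 2 * \<Lambda> - 1 + E g / B)"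
    using int_E int_X by (intro integral_mono ptw integrable_mult_right integrable_MAX D) auto
  also have "\<dots> = 2 * \<Lambda> - 1 + expectation E / B"
    using int_E by (simp add: prob_space)
  also have "\<dots> \<le> 2 * \<Lambda>"
    using E_le by (simp add: B_def)
  finally have "expectation (\<lambda>g. MAX d\<in>D. \<bar>X d g\<bar>) \<le> 2 * \<Lambda> / l"
    using l by (simp add: field_simps)
  also have "\<dots> = \<sigma> * sqrt (2 * \<Lambda>)"
    using l \<sigma> \<Lambda> by (simp add: l_def real_div_sqrt field_simps flip: real_sqrt_mult)
  finally show ?thesis by (simp add: X_def \<Lambda>_def)
qed

section \<open>Synthesis from a dictionary\<close>

text \<open>Exhibits a linear functional of the synthesised vector as a pairing of the coefficients
  with its values on the dictionary, so that the duality between the l1 and the maximum norm applies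
  to it.\<close>

lemma sum_mult_dict_comb:
  "(\<Sum>j<n. a j * dict_comb N d h j) = (\<Sum>k<N. h k * (\<Sum>j<n. a j * d k j))"
  unfolding dict_comb_def sum_distrib_left by (subst sum.swap) (simp add: mult_ac)

lemma dict_comb_diff: "dict_comb N d (\<lambda>i. a i - b i) = (\<lambda>j. dict_comb N d a j - dict_comb N d b j)"
  by (simp add: dict_comb_def left_diff_distrib sum_subtractf)

lemma l2_norm_dict_comb_le:
  assumes "\<forall>k<N. l2_norm n (d k) \<le> 1"
  shows "l2_norm n (dict_comb N d h) \<le> l1_norm N h"
  using assms
proof (induction N)
  case (Suc N)
  have "l2_norm n (dict_comb (Suc N) d h) \<le> l2_norm n (dict_comb N d h) + l2_norm n (\<lambda>j. h N * d N j)"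
    using L2_set_triangle_ineq[of "dict_comb N d h" "\<lambda>j. h N * d N j" "{..<n}"] by (simp add: dict_comb_def)
  also have "l2_norm n (\<lambda>j. h N * d N j) = \<bar>h N\<bar> * l2_norm n (d N)"
    by (simp add: L2_set_right_distrib) (simp add: L2_set_def power_mult_distrib)
  finally show ?case
    using Suc mult_left_mono[of "l2_norm n (d N)" 1 "\<bar>h N\<bar>"] by (simp add: l1_norm_def)
qed (simp add: dict_comb_def l1_norm_def L2_set_def)

text \<open>Cauchy-Schwarz against the indicator of the support.\<close>

lemma l1_norm_le_sqrt_l2_norm:
  assumes "card {i. i < N \<and> a i \<noteq> 0} \<le> s"
  shows "l1_norm N a \<le> sqrt (real s) * l2_norm N a"
proof -
  let ?S = "{i. i < N \<and> a i \<noteq> 0}"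
  have "l1_norm N a = (\<Sum>i<N. \<bar>a i\<bar> * \<bar>indicator ?S i\<bar>)"
    unfolding l1_norm_def by (intro sum.cong) (auto simp: indicator_def)
  also have "\<dots> \<le> l2_norm N a * l2_norm N (indicator ?S)"
    by (rule L2_set_mult_ineq)
  also have "l2_norm N (indicator ?S) = sqrt (real (card ?S))"
  proof -
    have "(\<Sum>i<N. (indicator ?S i :: real)\<^sup>2) = (\<Sum>i\<in>?S. 1)"
      by (intro sum.mono_neutral_cong_right) (auto simp: indicator_def)
    then show ?thesis by (simp add: L2_set_def)
  qed
  also have "l2_norm N a * sqrt (real (card ?S)) \<le> l2_norm N a * sqrt (real s)"
    using assms by (intro mult_left_mono) auto
  finally show ?thesis by (simp add: mult.commute)
qed

section \<open>Finite nets in the l1 ball of coefficient vectors\<close>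

definition l1_net :: "nat \<Rightarrow> real \<Rightarrow> nat \<Rightarrow> (nat \<Rightarrow> real) set" where
  "l1_net N R q = {h. (\<forall>i<N. \<exists>z::int. h i = of_int z / real q) \<and> (\<forall>i\<ge>N. h i = 0) \<and> l1_norm N h \<le> R}"

text \<open>The numerators satisfy |z i| = q |h i| <= q R, which leaves finitely many choices for
  each of the first \<open>N\<close> coordinates; the definition pins all later coordinates to
  0.\<close>

lemma finite_l1_net:
  assumes "1 \<le> q"
  shows "finite (l1_net N R q)"
proof (rule finite_subset)
  let ?Z = "{- \<lceil>real q * R\<rceil>..\<lceil>real q * R\<rceil>}"
  show "finite ((\<lambda>f i. if i < N then of_int (f i) / real q else 0) ` ({..<N} \<rightarrow>\<^sub>E ?Z))"
    by (intro finite_imageI finite_PiE) auto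
  show "l1_net N R q \<subseteq> (\<lambda>f i. if i < N then of_int (f i) / real q else 0) ` ({..<N} \<rightarrow>\<^sub>E ?Z)"
  proof
    fix h assume h: "h \<in> l1_net N R q"
    then obtain z where z: "\<And>i. i < N \<Longrightarrow> h i = of_int (z i) / real q"
      unfolding l1_net_def by (auto simp: choice_iff')
    have "z i \<in> ?Z" if "i < N" for i
    proof -
      have "\<bar>of_int (z i)\<bar> = real q * \<bar>h i\<bar>" using z[OF that] assms by (simp add: abs_mult)
      also have "\<bar>h i\<bar> \<le> l1_norm N h" unfolding l1_norm_def using that by (intro member_le_sum) auto
      also have "\<dots> \<le> R" using h by (simp add: l1_net_def)
      finally have "\<bar>of_int (z i)\<bar> \<le> real q * R" by (simp add: mult_left_mono)
      then show ?thesis by (simp add: abs_le_iff) linarith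
    qed
    then show "h \<in> (\<lambda>f i. if i < N then of_int (f i) / real q else 0) ` ({..<N} \<rightarrow>\<^sub>E ?Z)"
      using h z by (intro image_eqI[of _ _ "restrict z {..<N}"]) (auto simp: l1_net_def fun_eq_iff)
  qed
qed

lemma zero_in_l1_net: "0 \<le> R \<Longrightarrow> (\<lambda>_. 0) \<in> l1_net N R q"
  by (auto simp: l1_net_def l1_norm_def intro!: exI[of _ 0])

lemma l1_net_approx:
  assumes q: "1 \<le> q" and h: "l1_norm N h \<le> R"
  obtains h' where "h' \<in> l1_net N R q" "l1_norm N (\<lambda>i. h i - h' i) \<le> real N / real q"
    "\<forall>i<N. \<bar>h i - h' i\<bar> \<le> 1 / real q"
proof -
  \<comment> \<open>Rounding goes towards zero, so no coordinate grows in absolute value and the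
    rounded vector stays in the ball of the same radius \<open>R\<close>.\<close>
  define z where "z i = (if 0 \<le> h i then \<lfloor>real q * h i\<rfloor> else \<lceil>real q * h i\<rceil>)" for i
  define h' where "h' i = (if i < N then of_int (z i) / real q else 0)" for i
  have z: "\<bar>of_int (z i)\<bar> \<le> real q * \<bar>h i\<bar>" "\<bar>real q * h i - of_int (z i)\<bar> \<le> 1" for i
  proof -
    have "0 \<le> h i \<Longrightarrow> 0 \<le> real q * h i" "\<not> 0 \<le> h i \<Longrightarrow> real q * h i \<le> 0"
      by (auto simp: mult_nonneg_nonpos)
    then show "\<bar>of_int (z i)\<bar> \<le> real q * \<bar>h i\<bar>" "\<bar>real q * h i - of_int (z i)\<bar> \<le> 1"
      unfolding z_def by (auto; linarith)+
  qed
  have "\<bar>h' i\<bar> \<le> \<bar>h i\<bar>" if "i < N" for i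
    using z(1)[of i] q that by (simp add: h'_def divide_le_eq mult.commute)
  then have "l1_norm N h' \<le> l1_norm N h"
    unfolding l1_norm_def by (intro sum_mono) auto
  then have 1: "h' \<in> l1_net N R q"
    using h by (auto simp: l1_net_def h'_def)
  have 2: "\<bar>h i - h' i\<bar> \<le> 1 / real q" if "i < N" for i
  proof -
    have "h i - h' i = (real q * h i - of_int (z i)) / real q" using q that by (simp add: h'_def diff_divide_distrib)
    then show ?thesis using z(2)[of i] q by (simp add: divide_right_mono)
  qed
  have "l1_norm N (\<lambda>i. h i - h' i) \<le> (\<Sum>i<N. 1 / real q)"
    unfolding l1_norm_def by (intro sum_mono 2) auto
  then show ?thesis using 1 2 by (intro that[of h']) auto
qed

text \<open>Each summand is centred: sqrt (2 / pi) times the Euclidean norm of a vector is the mean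
  absolute inner product of that vector with a standard Gaussian row. The index is the coefficient
  vector, since it is the l1 norm of the coefficients that is controlled.\<close>

definition dict_deviation :: "nat \<Rightarrow> nat \<Rightarrow> nat \<Rightarrow> (nat \<Rightarrow> nat \<Rightarrow> real) \<Rightarrow> (nat \<times> nat \<Rightarrow> real) \<Rightarrow> (nat \<Rightarrow> real) \<Rightarrow> real" where
  "dict_deviation m n N d g h =
     (\<Sum>i<m. sqrt (2 / pi) * l2_norm n (dict_comb N d h) - \<bar>\<Sum>j<n. g (i, j) * dict_comb N d h j\<bar>)"

lemma integrable_dict_deviation:
  "integrable (std_gauss_vec ({..<m} \<times> {..<n})) (\<lambda>g. dict_deviation m n N d g h)"
proof -
  interpret prob_space "std_gauss_vec ({..<m} \<times> {..<n})" by (rule prob_space_std_gauss_vec)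
  show ?thesis
    unfolding dict_deviation_def
    by (intro Bochner_Integration.integrable_sum Bochner_Integration.integrable_diff integrable_abs
        integrable_std_gauss_vec_row integrable_const) auto
qed

lemma integral_MAX_dict_deviation_le:
  assumes m: "1 \<le> m" and N: "1 \<le> N" and R: "0 \<le> R"
    and d: "\<forall>k<N. l2_norm n (d k) \<le> 1"
    and F: "finite F" "F \<noteq> {}" "\<And>h. h \<in> F \<Longrightarrow> l1_norm N h \<le> R"
  shows "(\<integral>g. (MAX h\<in>F. dict_deviation m n N d g h) \<partial>std_gauss_vec ({..<m} \<times> {..<n}))
      \<le> 2 * R * (sqrt (real m) * sqrt (2 * ln (2 * real N)))"
proof -
  let ?K = "{..<m} \<times> {..<n}"
  define X where "X k g = (\<Sum>p\<in>?K. g p * d k (snd p))" for k :: nat and g :: "nat \<times> nat \<Rightarrow> real"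
  have int_X: "integrable (std_gauss_vec ?K) (X k)" for k
    unfolding X_def by (intro Bochner_Integration.integrable_sum integrable_mult_left integrable_std_gauss_vec_component)
  have int_rows: "integrable (std_gauss_vec ?K) (\<lambda>g. \<Sum>i<m. \<Sum>j<n. g (i, j) * w j)" for w
    by (rule Bochner_Integration.integrable_sum) (rule integrable_std_gauss_vec_row, auto)
  \<comment> \<open>\<open>X k\<close> is the inner product of \<open>d k\<close> with the sum of
    all rows, so the weights of \<open>d k\<close> occur once in each of the \<open>m\<close> rows
    and the variance is at most \<open>m\<close>.\<close>
  have "L2_set (\<lambda>p. d k (snd p)) ?K = sqrt (real m) * l2_norm n (d k)" for k
    by (simp add: L2_set_def sum.cartesian_product' real_sqrt_mult)
  then have L2: "L2_set (\<lambda>p. d k (snd p)) ?K \<le> sqrt (real m)" if "k < N" for k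
    using d that by (simp add: mult_left_le)
  have ptw: "(MAX h\<in>F. 0 + 2 * (\<Sum>i<m. \<Sum>j<n. g (i, j) * dict_comb N d h j)) \<le> 2 * R * (MAX k\<in>{..<N}. \<bar>X k g\<bar>)" for g
  proof (intro Max.boundedI)
    fix a assume "a \<in> (\<lambda>h. 0 + 2 * (\<Sum>i<m. \<Sum>j<n. g (i, j) * dict_comb N d h j)) ` F"
    then obtain h where h: "h \<in> F" "a = 2 * (\<Sum>i<m. \<Sum>j<n. g (i, j) * dict_comb N d h j)" by auto
    \<comment> \<open>Duality of the l1 and the maximum norm: the pairing of \<open>h\<close> with
      the values \<open>X k g\<close> is at most the l1 norm of \<open>h\<close> times the largest
      |X k g|.\<close>
    have "(\<Sum>i<m. \<Sum>j<n. g (i, j) * dict_comb N d h j) = (\<Sum>k<N. h k * X k g)"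
      unfolding sum_mult_dict_comb X_def sum.cartesian_product'
      by (subst sum.swap) (simp add: sum_distrib_left)
    also have "\<dots> \<le> (\<Sum>k<N. \<bar>h k\<bar> * (MAX k\<in>{..<N}. \<bar>X k g\<bar>))"
    proof (intro sum_mono)
      fix k assume "k \<in> {..<N}"
      then have "\<bar>X k g\<bar> \<le> (MAX k\<in>{..<N}. \<bar>X k g\<bar>)" by (intro Max_ge) auto
      then have "\<bar>h k * X k g\<bar> \<le> \<bar>h k\<bar> * (MAX k\<in>{..<N}. \<bar>X k g\<bar>)"
        by (simp add: abs_mult mult_left_mono)
      then show "h k * X k g \<le> \<bar>h k\<bar> * (MAX k\<in>{..<N}. \<bar>X k g\<bar>)" by linarith
    qed
    also have "\<dots> = l1_norm N h * (MAX k\<in>{..<N}. \<bar>X k g\<bar>)"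
      by (simp add: l1_norm_def sum_distrib_right)
    also have "\<dots> \<le> R * (MAX k\<in>{..<N}. \<bar>X k g\<bar>)"
    proof (intro mult_right_mono F(3) h(1))
      have "\<bar>X 0 g\<bar> \<le> (MAX k\<in>{..<N}. \<bar>X k g\<bar>)" using N by (intro Max_ge) auto
      then show "0 \<le> (MAX k\<in>{..<N}. \<bar>X k g\<bar>)" by linarith
    qed
    finally show "a \<le> 2 * R * (MAX k\<in>{..<N}. \<bar>X k g\<bar>)" by (simp add: h(2))
  qed (use F in auto)
  have "(\<integral>g. (MAX h\<in>F. dict_deviation m n N d g h) \<partial>std_gauss_vec ?K)
      \<le> (\<integral>g. (MAX h\<in>F. 0 + 2 * (\<Sum>i<m. \<Sum>j<n. g (i, j) * dict_comb N d h j)) \<partial>std_gauss_vec ?K)"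
    using integral_MAX_centred_rows_le[of "{..<m}" "{..<n}" F "\<lambda>_. 0" "dict_comb N d"] F
    by (simp add: dict_deviation_def)
  also have "\<dots> \<le> (\<integral>g. 2 * R * (MAX k\<in>{..<N}. \<bar>X k g\<bar>) \<partial>std_gauss_vec ?K)"
    using N int_rows int_X
    by (intro integral_mono ptw integrable_MAX integrable_mult_right F) (auto simp: lessThan_empty_iff)
  also have "\<dots> = 2 * R * (\<integral>g. (MAX k\<in>{..<N}. \<bar>X k g\<bar>) \<partial>std_gauss_vec ?K)" by simp
  also have "\<dots> \<le> 2 * R * (sqrt (real m) * sqrt (2 * ln (2 * real (card {..<N}))))"
    unfolding X_def using R m N L2
    by (intro mult_left_mono integral_MAX_abs_std_gauss_vec_sum_le) (auto simp: lessThan_empty_iff)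
  finally show ?thesis by simp
qed

text \<open>A deterministic inequality for each fixed \<open>g\<close>, so \<open>h\<close> may
  later depend on the sample point in any way. Moving from \<open>h\<close> to a nearby net point
  changes both the Euclidean norm of the synthesised vector and its measurements; these two errors
  form the last term, of order 1 / q.\<close>

lemma l2_norm_dict_comb_le_deviation:
  assumes d: "\<forall>k<N. l2_norm n (d k) \<le> 1" and q: "1 \<le> q" and h: "l1_norm N h \<le> R"
  shows "real m * sqrt (2 / pi) * l2_norm n (dict_comb N d h)
      \<le> (\<Sum>i<m. \<bar>\<Sum>j<n. g (i, j) * dict_comb N d h j\<bar>) + (MAX h\<in>l1_net N R q. dict_deviation m n N d g h)
        + (real m * sqrt (2 / pi) * real N + (\<Sum>i<m. \<Sum>k<N. \<bar>\<Sum>j<n. g (i, j) * d k j\<bar>)) / real q"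
proof -
  obtain h' where h': "h' \<in> l1_net N R q" and l1: "l1_norm N (\<lambda>i. h i - h' i) \<le> real N / real q"
    and close: "\<forall>i<N. \<bar>h i - h' i\<bar> \<le> 1 / real q"
    using l1_net_approx[OF q h] .
  define u where "u = dict_comb N d h"
  define u' where "u' = dict_comb N d h'"
  have diff: "dict_comb N d (\<lambda>i. h i - h' i) = (\<lambda>j. u j - u' j)"
    unfolding dict_comb_diff u_def u'_def ..
  have "l2_norm n u \<le> l2_norm n u' + l2_norm n (\<lambda>j. u j - u' j)"
    using L2_set_triangle_ineq[of u' "\<lambda>j. u j - u' j"] by simp
  also have "l2_norm n (\<lambda>j. u j - u' j) \<le> real N / real q"
    using l2_norm_dict_comb_le[OF d, of "\<lambda>i. h i - h' i"] l1 by (simp add: diff)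
  finally have "real m * sqrt (2 / pi) * l2_norm n u \<le> real m * sqrt (2 / pi) * (l2_norm n u' + real N / real q)"
    by (intro mult_left_mono) auto
  moreover have "(\<Sum>i<m. \<bar>\<Sum>j<n. g (i, j) * u' j\<bar>) \<le> (\<Sum>i<m. \<bar>\<Sum>j<n. g (i, j) * u j\<bar> + (\<Sum>k<N. \<bar>\<Sum>j<n. g (i, j) * d k j\<bar>) / real q)"
  proof (intro sum_mono)
    fix i
    have "(\<Sum>j<n. g (i, j) * u j) - (\<Sum>j<n. g (i, j) * u' j) = (\<Sum>k<N. (h k - h' k) * (\<Sum>j<n. g (i, j) * d k j))"
      unfolding sum_mult_dict_comb[symmetric] diff by (simp add: sum_subtractf right_diff_distrib)
    also have "\<bar>\<dots>\<bar> \<le> (\<Sum>k<N. \<bar>(h k - h' k) * (\<Sum>j<n. g (i, j) * d k j)\<bar>)"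
      by (rule sum_abs)
    also have "\<dots> \<le> (\<Sum>k<N. 1 / real q * \<bar>\<Sum>j<n. g (i, j) * d k j\<bar>)"
      unfolding abs_mult using close by (intro sum_mono mult_right_mono) auto
    finally show "\<bar>\<Sum>j<n. g (i, j) * u' j\<bar> \<le> \<bar>\<Sum>j<n. g (i, j) * u j\<bar> + (\<Sum>k<N. \<bar>\<Sum>j<n. g (i, j) * d k j\<bar>) / real q"
      by (simp add: sum_divide_distrib)
  qed
  moreover have "dict_deviation m n N d g h' \<le> (MAX h\<in>l1_net N R q. dict_deviation m n N d g h)"
    using finite_l1_net[OF q] h' by (intro Max_ge) auto
  moreover have "dict_deviation m n N d g h' = real m * sqrt (2 / pi) * l2_norm n u' - (\<Sum>i<m. \<bar>\<Sum>j<n. g (i, j) * u' j\<bar>)"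
    by (simp add: dict_deviation_def u'_def sum_subtractf)
  ultimately show ?thesis
    unfolding u_def[symmetric]
    by (simp add: sum.distrib sum_divide_distrib[symmetric] distrib_left add_divide_distrib)
qed

text \<open>Carries expectations over the given probability space to the product Gaussian measure.
  Positive \<open>m\<close> and \<open>n\<close> make the index set nonempty, as the
  characterization of independence by the joint law demands.\<close>

lemma std_gaussian_matrix_distr:
  assumes M: "prob_space M" and A: "std_gaussian_matrix M m n A" and mn: "1 \<le> m" "1 \<le> n"
  defines "K \<equiv> {..<m} \<times> {..<n}"
  defines "X \<equiv> \<lambda>\<omega>. \<lambda>k\<in>K. A \<omega> (fst k) (snd k)"
  shows "X \<in> M \<rightarrow>\<^sub>M std_gauss_vec K" and "distr M (std_gauss_vec K) X = std_gauss_vec K"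
proof -
  interpret prob_space M by fact
  have ind: "indep_vars (\<lambda>_. borel) (\<lambda>k \<omega>. A \<omega> (fst k) (snd k)) K"
    using A by (simp add: std_gaussian_matrix_def K_def case_prod_unfold)
  have D: "distributed M lborel (\<lambda>\<omega>. A \<omega> (fst k) (snd k)) std_normal_density" if "k \<in> K" for k
    using A that by (auto simp: std_gaussian_matrix_def K_def)
  have meas: "(\<lambda>\<omega>. A \<omega> (fst k) (snd k)) \<in> borel_measurable M" if "k \<in> K" for k
    using D[OF that] by (simp add: distributed_def)
  show "X \<in> M \<rightarrow>\<^sub>M std_gauss_vec K"
    unfolding X_def using meas by (intro measurable_restrict) simp
  have ne: "K \<noteq> {}" using mn by (auto simp: K_def lessThan_empty_iff)
  have "distr M (std_gauss_vec K) X = distr M (PiM K (\<lambda>_. borel)) X"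
    by (intro distr_cong sets_PiM_cong) auto
  also have "\<dots> = PiM K (\<lambda>k. distr M borel (\<lambda>\<omega>. A \<omega> (fst k) (snd k)))"
    using iffD1[OF indep_vars_iff_distr_eq_PiM'[OF ne meas] ind] by (simp add: X_def)
  also have "\<dots> = std_gauss_vec K"
  proof (intro PiM_cong refl)
    fix k assume k: "k \<in> K"
    have "distr M borel (\<lambda>\<omega>. A \<omega> (fst k) (snd k)) = distr M lborel (\<lambda>\<omega>. A \<omega> (fst k) (snd k))"
      by (intro distr_cong) auto
    then show "distr M borel (\<lambda>\<omega>. A \<omega> (fst k) (snd k)) = std_gauss"
      using D[OF k] by (simp add: distributed_def std_gauss_def)
  qed
  finally show "distr M (std_gauss_vec K) X = std_gauss_vec K" .
qed

section \<open>The recovery error\<close>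

text \<open>The error bound in terms of the l1 norm of \<alpha>, before sparsity enters. Rearranging
  the definition of the deviation bounds the Euclidean error by the measured error plus the
  deviation, and the latter is bounded in mean uniformly over the l1 ball.\<close>

lemma program_error_le:
  fixes d :: "nat \<Rightarrow> nat \<Rightarrow> real"
  assumes m: "1 \<le> m" and n: "1 \<le> n" and N: "1 \<le> N"
    and d: "\<forall>i<N. l2_norm n (d i) \<le> 1"
    and M: "prob_space M" and A: "std_gaussian_matrix M m n A"
    and \<nu>: "\<And>\<omega>. \<omega> \<in> space M \<Longrightarrow> l1_norm m (\<nu> \<omega>) / real m \<le> \<epsilon>"
    and y: "\<And>\<omega>. \<omega> \<in> space M \<Longrightarrow> y \<omega> = (\<lambda>i. mat_vec n (A \<omega>) (dict_comb N d \<alpha>) i + \<nu> \<omega> i)"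
    and sol: "\<And>\<omega>. \<omega> \<in> space M \<Longrightarrow> program_solution m n N d (A \<omega>) (y \<omega>) \<epsilon> (\<alpha>h \<omega>)"
    and meas: "(\<lambda>\<omega>. l2_norm n (dict_comb N d (\<lambda>i. \<alpha>h \<omega> i - \<alpha> i))) \<in> borel_measurable M"
  shows "integrable M (\<lambda>\<omega>. l2_norm n (dict_comb N d (\<lambda>i. \<alpha>h \<omega> i - \<alpha> i)))" (is "integrable M ?e")
    and "(\<integral>\<omega>. l2_norm n (dict_comb N d (\<lambda>i. \<alpha>h \<omega> i - \<alpha> i)) \<partial>M)
      \<le> sqrt (pi / 2) * (2 * \<epsilon> + 4 * l1_norm N \<alpha> * sqrt (2 * ln (2 * real N) / real m))"
proof -
  interpret prob_space M by fact
  let ?K = "{..<m} \<times> {..<n}"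
  let ?G = "std_gauss_vec ?K"
  interpret G: prob_space ?G by (rule prob_space_std_gauss_vec)
  define R where "R = 2 * l1_norm N \<alpha>"
  define X where "X = (\<lambda>\<omega>. \<lambda>k\<in>?K. A \<omega> (fst k) (snd k))"
  define h where "h \<omega> = (\<lambda>i. \<alpha>h \<omega> i - \<alpha> i)" for \<omega>
  define \<Phi> where "\<Phi> q g = (MAX h\<in>l1_net N R q. dict_deviation m n N d g h)" for q g
  define Y where "Y g = real m * sqrt (2 / pi) * real N + (\<Sum>i<m. \<Sum>k<N. \<bar>\<Sum>j<n. g (i, j) * d k j\<bar>)" for g :: "nat \<times> nat \<Rightarrow> real"
  have R: "0 \<le> R" by (simp add: R_def l1_norm_def sum_nonneg)
  have X: "X \<in> M \<rightarrow>\<^sub>M ?G" "distr M ?G X = ?G"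
    unfolding X_def by (rule std_gaussian_matrix_distr[OF M A m n])+
  txt \<open>No measurability in \<open>\<omega>\<close> of the minimizer is available; the net replaces it by finitely many
    fixed vectors, and its mesh \<open>1 / q\<close> is sent to \<open>0\<close> only after integrating.\<close>
  have net: "finite (l1_net N R q)" "l1_net N R q \<noteq> {}" if "1 \<le> q" for q
    using finite_l1_net[OF that] zero_in_l1_net[OF R] by blast+
  have int_\<Phi>: "integrable ?G (\<Phi> q)" if "1 \<le> q" for q
    unfolding \<Phi>_def by (intro integrable_MAX net[OF that] integrable_dict_deviation)
  have int_\<Phi>_le: "integral\<^sup>L ?G (\<Phi> q) \<le> 2 * R * (sqrt (real m) * sqrt (2 * ln (2 * real N)))" if "1 \<le> q" for q
    unfolding \<Phi>_def by (intro integral_MAX_dict_deviation_le m N R d net[OF that]) (simp add: l1_net_def)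
  have int_Y: "integrable ?G Y"
    unfolding Y_def
    by (intro Bochner_Integration.integrable_add Bochner_Integration.integrable_sum[where I="{..<m}"]
        Bochner_Integration.integrable_sum[where I="{..<N}"] integrable_abs integrable_std_gauss_vec_row G.integrable_const) auto
  have transfer: "integrable M (\<lambda>\<omega>. f (X \<omega>))" "(\<integral>\<omega>. f (X \<omega>) \<partial>M) = integral\<^sup>L ?G f"
    if "integrable ?G f" for f :: "_ \<Rightarrow> real"
    using that integrable_distr[OF X(1), of f] integral_distr[OF X(1), of f] X(2) by auto
  have feasible_l1: "l1_norm m (\<lambda>i. mat_vec n (A \<omega>) (dict_comb N d a) i - y \<omega> i) \<le> real m * \<epsilon>"
    if "feasible m n N d (A \<omega>) (y \<omega>) \<epsilon> a" for a \<omega>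
    using that m by (simp add: feasible_def divide_le_eq mult.commute)
  have l1_h: "l1_norm N (h \<omega>) \<le> R"
    and l1_Ah: "(\<Sum>i<m. \<bar>\<Sum>j<n. X \<omega> (i, j) * dict_comb N d (h \<omega>) j\<bar>) \<le> 2 * real m * \<epsilon>" if \<omega>: "\<omega> \<in> space M" for \<omega>
  proof -
    \<comment> \<open>The residual of \<alpha> is the negative of the noise; hence the minimizer has
      l1 norm at most that of \<alpha>.\<close>
    have "feasible m n N d (A \<omega>) (y \<omega>) \<epsilon> \<alpha>"
      using \<nu>[OF \<omega>] by (simp add: feasible_def y[OF \<omega>] l1_norm_def)
    then have le: "l1_norm N (\<alpha>h \<omega>) \<le> l1_norm N \<alpha>" and fh: "feasible m n N d (A \<omega>) (y \<omega>) \<epsilon> (\<alpha>h \<omega>)"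
      using sol[OF \<omega>] by (auto simp: program_solution_def is_arg_min_linorder)
    have "l1_norm N (h \<omega>) \<le> l1_norm N (\<alpha>h \<omega>) + l1_norm N \<alpha>"
      unfolding l1_norm_def h_def sum.distrib[symmetric] by (intro sum_mono) simp
    then show "l1_norm N (h \<omega>) \<le> R" using le by (simp add: R_def)
    \<comment> \<open>The measured error is the residual of the minimizer plus the noise, and each
      has l1 norm at most m \<epsilon>.\<close>
    have "(\<Sum>i<m. \<bar>\<Sum>j<n. X \<omega> (i, j) * dict_comb N d (h \<omega>) j\<bar>)
        = (\<Sum>i<m. \<bar>(mat_vec n (A \<omega>) (dict_comb N d (\<alpha>h \<omega>)) i - y \<omega> i) + \<nu> \<omega> i\<bar>)"
      by (intro sum.cong refl arg_cong[where f=abs])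
         (simp add: X_def h_def dict_comb_diff mat_vec_def y[OF \<omega>] sum_subtractf right_diff_distrib)
    also have "\<dots> \<le> l1_norm m (\<lambda>i. mat_vec n (A \<omega>) (dict_comb N d (\<alpha>h \<omega>)) i - y \<omega> i) + l1_norm m (\<nu> \<omega>)"
      unfolding l1_norm_def sum.distrib[symmetric] by (intro sum_mono) (rule abs_triangle_ineq)
    also have "\<dots> \<le> real m * \<epsilon> + real m * \<epsilon>"
      using \<nu>[OF \<omega>] m by (intro add_mono feasible_l1 fh) (simp add: divide_le_eq mult.commute)
    finally show "(\<Sum>i<m. \<bar>\<Sum>j<n. X \<omega> (i, j) * dict_comb N d (h \<omega>) j\<bar>) \<le> 2 * real m * \<epsilon>" by (simp add: mult_ac)
  qed
  define c where "c = real m * sqrt (2 / pi)"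
  have c: "c > 0" using m by (simp add: c_def)
  have ptw: "c * ?e \<omega> \<le> 2 * real m * \<epsilon> + \<Phi> q (X \<omega>) + Y (X \<omega>) / real q" if "1 \<le> q" "\<omega> \<in> space M" for q \<omega>
    using l2_norm_dict_comb_le_deviation[OF d that(1) l1_h[OF that(2)], where m=m and g="X \<omega>"] l1_Ah[OF that(2)]
    unfolding c_def \<Phi>_def Y_def h_def by linarith
  have int_dom: "integrable M (\<lambda>\<omega>. 2 * real m * \<epsilon> + \<Phi> q (X \<omega>) + Y (X \<omega>) / real q)" if "1 \<le> q" for q
    using transfer(1)[OF int_\<Phi>[OF that]] transfer(1)[OF int_Y] by simp
  \<comment> \<open>The crudest mesh, q = 1, already provides an integrable majorant.\<close>
  have "integrable M (\<lambda>\<omega>. c * ?e \<omega>)"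
  proof (rule Bochner_Integration.integrable_bound[OF int_dom[of 1]])
    show "AE \<omega> in M. norm (c * ?e \<omega>) \<le> norm (2 * real m * \<epsilon> + \<Phi> 1 (X \<omega>) + Y (X \<omega>) / real 1)"
      using ptw[of 1] c by (intro AE_I2) (auto intro: order_trans[OF _ abs_ge_self] simp: abs_mult)
  qed (use meas in auto)
  then show int_e: "integrable M ?e" using c by simp
  have "c * expectation ?e \<le> 2 * real m * \<epsilon> + 2 * R * (sqrt (real m) * sqrt (2 * ln (2 * real N))) + integral\<^sup>L ?G Y / real q"
    if q: "1 \<le> q" for q
  proof -
    have "c * expectation ?e = expectation (\<lambda>\<omega>. c * ?e \<omega>)" by simp
    also have "\<dots> \<le> expectation (\<lambda>\<omega>. 2 * real m * \<epsilon> + \<Phi> q (X \<omega>) + Y (X \<omega>) / real q)"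
      using int_e int_dom[OF q] ptw[OF q] by (intro integral_mono) auto
    also have "\<dots> = 2 * real m * \<epsilon> + integral\<^sup>L ?G (\<Phi> q) + integral\<^sup>L ?G Y / real q"
      using transfer[OF int_\<Phi>[OF q]] transfer[OF int_Y] by (simp add: prob_space)
    finally show ?thesis using int_\<Phi>_le[OF q] by linarith
  qed
  \<comment> \<open>Only the last term depends on the mesh, and it tends to 0 as \<open>q\<close>
    grows.\<close>
  then have "c * expectation ?e \<le> 2 * real m * \<epsilon> + 2 * R * (sqrt (real m) * sqrt (2 * ln (2 * real N)))"
    by (intro LIMSEQ_le_const[where X="\<lambda>q. 2 * real m * \<epsilon> + 2 * R * (sqrt (real m) * sqrt (2 * ln (2 * real N))) + integral\<^sup>L ?G Y / real q"])
       (auto intro!: tendsto_eq_intros lim_const_over_n)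
  then have "expectation ?e \<le> (2 * real m * \<epsilon> + 2 * R * (sqrt (real m) * sqrt (2 * ln (2 * real N)))) / c"
    using c by (simp add: le_divide_eq mult.commute)
  also have "\<dots> = sqrt (pi / 2) * (2 * \<epsilon> + 4 * l1_norm N \<alpha> * sqrt (2 * ln (2 * real N) / real m))"
  proof -
    have "sqrt (real m) / real m = 1 / sqrt (real m)" using m by (simp add: field_simps)
    then have "(2 * real m * \<epsilon> + 2 * R * (sqrt (real m) * L)) / real m = 2 * \<epsilon> + 4 * l1_norm N \<alpha> * (L / sqrt (real m))" for L
      using m by (simp add: add_divide_distrib R_def) (simp add: field_simps)
    moreover have "a / c = sqrt (pi / 2) * (a / real m)" for a
      by (simp add: c_def real_sqrt_divide mult_ac)
    ultimately show ?thesis by (simp only: real_sqrt_divide)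
  qed
  finally show "expectation ?e \<le> sqrt (pi / 2) * (2 * \<epsilon> + 4 * l1_norm N \<alpha> * sqrt (2 * ln (2 * real N) / real m))" .
qed

text \<open>For N >= 2, ln (2 N) <= 2 ln N, so the square root of 2 ln (2 N) / m is at most twice
  that of ln N / m; with the factor 4 this makes 8. The noise coefficient is exact, as 2 sqrt (pi /
  2) = sqrt (2 pi).\<close>

lemma error_bound_le:
  assumes N: "2 \<le> N" and a: "0 \<le> a"
  shows "sqrt (pi / 2) * (2 * \<epsilon> + 4 * (sqrt (real s) * a) * sqrt (2 * ln (2 * real N) / real m))
    \<le> 8 * sqrt (pi / 2) * sqrt (real s * ln (real N) / real m) * a + sqrt (2 * pi) * \<epsilon>"
proof -
  have "ln (2 * real N) \<le> ln (real N * real N)"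
    using N by (subst ln_le_cancel_iff) (auto intro!: mult_right_mono)
  also have "\<dots> = 2 * ln (real N)" using N by (simp add: ln_mult)
  finally have "sqrt (2 * ln (2 * real N) / real m) \<le> sqrt (4 * (ln (real N) / real m))"
    by (intro real_sqrt_le_mono) (simp add: divide_right_mono)
  also have "\<dots> = 2 * sqrt (ln (real N) / real m)" by (subst real_sqrt_mult) simp
  finally have "4 * (sqrt (real s) * a) * sqrt (2 * ln (2 * real N) / real m)
      \<le> 4 * (sqrt (real s) * a) * (2 * sqrt (ln (real N) / real m))"
    using a by (intro mult_left_mono) auto
  also have "\<dots> = 8 * sqrt (real s * ln (real N) / real m) * a"
    by (simp add: real_sqrt_mult real_sqrt_divide)
  finally have "sqrt (pi / 2) * (2 * \<epsilon> + 4 * (sqrt (real s) * a) * sqrt (2 * ln (2 * real N) / real m))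
      \<le> sqrt (pi / 2) * (2 * \<epsilon> + 8 * sqrt (real s * ln (real N) / real m) * a)"
    by (intro mult_left_mono) auto
  also have "\<dots> = 8 * sqrt (pi / 2) * sqrt (real s * ln (real N) / real m) * a + (sqrt (pi / 2) * 2) * \<epsilon>"
    by (simp only: distrib_left mult_ac add_ac)
  also have "sqrt (pi / 2) * 2 = sqrt (2 * pi)"
    by (rule real_sqrt_unique[symmetric]) (auto simp: power_mult_distrib)
  finally show ?thesis .
qed

theorem theorem7p1:
  "\<exists>C::real. C > 0 \<and>
    (\<forall>(m::nat) (n::nat) (N::nat) (s::nat) (d :: nat \<Rightarrow> nat \<Rightarrow> real) (\<alpha> :: nat \<Rightarrow> real) (\<epsilon>::real)
       (M :: (nat \<Rightarrow> real) measure) (A :: (nat \<Rightarrow> real) \<Rightarrow> nat \<Rightarrow> nat \<Rightarrow> real)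
       (\<nu> :: (nat \<Rightarrow> real) \<Rightarrow> nat \<Rightarrow> real) (y :: (nat \<Rightarrow> real) \<Rightarrow> nat \<Rightarrow> real)
       (\<alpha>h :: (nat \<Rightarrow> real) \<Rightarrow> nat \<Rightarrow> real)
       (x :: nat \<Rightarrow> real) (xh :: (nat \<Rightarrow> real) \<Rightarrow> nat \<Rightarrow> real).
       1 \<le> m \<longrightarrow> 1 \<le> n \<longrightarrow> 2 \<le> N \<longrightarrow> 1 \<le> s \<longrightarrow> 0 \<le> \<epsilon> \<longrightarrow>
       (\<forall>i<N. l2_norm n (d i) \<le> 1) \<longrightarrow>
       card {i. i < N \<and> \<alpha> i \<noteq> 0} \<le> s \<longrightarrow>
       x = dict_comb N d \<alpha> \<longrightarrow>
       prob_space M \<longrightarrow> std_gaussian_matrix M m n A \<longrightarrow>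
       (\<forall>\<omega>\<in>space M. l1_norm m (\<nu> \<omega>) / real m \<le> \<epsilon>) \<longrightarrow>
       (\<forall>\<omega>\<in>space M. y \<omega> = (\<lambda>i. mat_vec n (A \<omega>) x i + \<nu> \<omega> i)) \<longrightarrow>
       (\<forall>\<omega>\<in>space M. program_solution m n N d (A \<omega>) (y \<omega>) \<epsilon> (\<alpha>h \<omega>)) \<longrightarrow>
       (\<forall>\<omega>\<in>space M. xh \<omega> = dict_comb N d (\<alpha>h \<omega>)) \<longrightarrow>
       (\<lambda>\<omega>. l2_norm n (\<lambda>j. xh \<omega> j - x j)) \<in> borel_measurable M \<longrightarrow>
       integrable M (\<lambda>\<omega>. l2_norm n (\<lambda>j. xh \<omega> j - x j)) \<and>
       (\<integral>\<omega>. l2_norm n (\<lambda>j. xh \<omega> j - x j) \<partial>M)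
         \<le> C * sqrt (real s * ln (real N) / real m) * l2_norm N \<alpha> + sqrt (2 * pi) * \<epsilon>)"
proof (intro exI[of _ "8 * sqrt (pi / 2)"] conjI allI impI)
  fix m n N s :: nat and d :: "nat \<Rightarrow> nat \<Rightarrow> real" and \<alpha> :: "nat \<Rightarrow> real" and \<epsilon> :: real
    and M :: "(nat \<Rightarrow> real) measure" and A :: "(nat \<Rightarrow> real) \<Rightarrow> nat \<Rightarrow> nat \<Rightarrow> real"
    and \<nu> y \<alpha>h :: "(nat \<Rightarrow> real) \<Rightarrow> nat \<Rightarrow> real" and x :: "nat \<Rightarrow> real" and xh :: "(nat \<Rightarrow> real) \<Rightarrow> nat \<Rightarrow> real"
  assume m: "1 \<le> m" and n: "1 \<le> n" and N: "2 \<le> N" and \<epsilon>: "0 \<le> \<epsilon>"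
    and d: "\<forall>i<N. l2_norm n (d i) \<le> 1" and s: "card {i. i < N \<and> \<alpha> i \<noteq> 0} \<le> s"
    and x: "x = dict_comb N d \<alpha>" and M: "prob_space M" and A: "std_gaussian_matrix M m n A"
    and \<nu>: "\<forall>\<omega>\<in>space M. l1_norm m (\<nu> \<omega>) / real m \<le> \<epsilon>"
    and y: "\<forall>\<omega>\<in>space M. y \<omega> = (\<lambda>i. mat_vec n (A \<omega>) x i + \<nu> \<omega> i)"
    and sol: "\<forall>\<omega>\<in>space M. program_solution m n N d (A \<omega>) (y \<omega>) \<epsilon> (\<alpha>h \<omega>)"
    and xh: "\<forall>\<omega>\<in>space M. xh \<omega> = dict_comb N d (\<alpha>h \<omega>)"
    and meas: "(\<lambda>\<omega>. l2_norm n (\<lambda>j. xh \<omega> j - x j)) \<in> borel_measurable M"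
  let ?e = "\<lambda>\<omega>. l2_norm n (dict_comb N d (\<lambda>i. \<alpha>h \<omega> i - \<alpha> i))"
  have e: "l2_norm n (\<lambda>j. xh \<omega> j - x j) = ?e \<omega>" if "\<omega> \<in> space M" for \<omega>
    using xh that by (simp add: x dict_comb_diff)
  have meas_e: "?e \<in> borel_measurable M"
    using meas e by (simp cong: measurable_cong)
  have N1: "1 \<le> N" using N by simp
  note error = program_error_le[OF m n N1 d M A bspec[OF \<nu>] bspec[OF y[unfolded x]] bspec[OF sol] meas_e]
  show "integrable M (\<lambda>\<omega>. l2_norm n (\<lambda>j. xh \<omega> j - x j))"
    using error(1) e by (simp cong: Bochner_Integration.integrable_cong)
  have "(\<integral>\<omega>. l2_norm n (\<lambda>j. xh \<omega> j - x j) \<partial>M) = (\<integral>\<omega>. ?e \<omega> \<partial>M)"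
    by (intro Bochner_Integration.integral_cong refl e)
  also have "\<dots> \<le> sqrt (pi / 2) * (2 * \<epsilon> + 4 * l1_norm N \<alpha> * sqrt (2 * ln (2 * real N) / real m))"
    by (rule error(2))
  \<comment> \<open>The one place where sparsity is used: it trades the l1 norm of \<alpha> for sqrt
    s times its Euclidean norm.\<close>
  also have "\<dots> \<le> sqrt (pi / 2) * (2 * \<epsilon> + 4 * (sqrt (real s) * l2_norm N \<alpha>) * sqrt (2 * ln (2 * real N) / real m))"
    using l1_norm_le_sqrt_l2_norm[OF s] N by (intro mult_left_mono add_left_mono mult_right_mono) auto
  also have "\<dots> \<le> 8 * sqrt (pi / 2) * sqrt (real s * ln (real N) / real m) * l2_norm N \<alpha> + sqrt (2 * pi) * \<epsilon>"
    by (rule error_bound_le[OF N]) simp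
  finally show "(\<integral>\<omega>. l2_norm n (\<lambda>j. xh \<omega> j - x j) \<partial>M)
      \<le> 8 * sqrt (pi / 2) * sqrt (real s * ln (real N) / real m) * l2_norm N \<alpha> + sqrt (2 * pi) * \<epsilon>" .
qed simp

end
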